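(* Let $\phi(q)=\sum_{n=0}^\infty \frac{q^{n^2}}{(-q^2;q^2)_n}$ be Ramanujan's third order mock theta function, and for $n\ge 1$ let $p_{do}(n)$ denote the number of partitions of $n$ into distinct parts with the smallest part being odd. Then \[ (-q;q)_\infty\,\phi(-q)=1+\sum_{n=1}^\infty p_{do}(n)q^n+\sum_{k=1}^\infty (-1)^k q^{k^2}. \]
   Context: Notation: $(a;q)_n=(1-a)(1-aq)\cdots(1-aq^{n-1})$ (with $(a;q)_0=1$) and $(a;q)_\infty=\prod_{n\ge 0}(1-aq^n)$, $|q|<1$ (equivalently, identities of formal power series in $q$). *)

theory Defs
  imports "HOL-Analysis.Analysis" "HOL-Library.Multiset"
begin

definition qpoch :: "complex \<Rightarrow> complex \<Rightarrow> nat \<Rightarrow> complex" where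
  "qpoch a q n = (\<Prod>k<n. 1 - a * q ^ k)"

definition qpoch_inf :: "complex \<Rightarrow> complex \<Rightarrow> complex" where
  "qpoch_inf a q = (\<Prod>k. 1 - a * q ^ k)"

definition mock_phi :: "complex \<Rightarrow> complex" where
  "mock_phi q = (\<Sum>n. q ^ (n\<^sup>2) / qpoch (- (q\<^sup>2)) (q\<^sup>2) n)"

definition partitions_of :: "nat \<Rightarrow> nat multiset set" where
  "partitions_of n = {p. (\<forall>x\<in>#p. x > 0) \<and> sum_mset p = n}"

definition distinct_parts :: "nat multiset \<Rightarrow> bool" where
  "distinct_parts p \<longleftrightarrow> (\<forall>x\<in>#p. count p x = 1)"

(* Only meaningful for n > 0: the empty partition of 0 has no smallest part. *)
definition p_do :: "nat \<Rightarrow> nat" where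
  "p_do n = card {p \<in> partitions_of n. distinct_parts p \<and> odd (Min (set_mset p))}"

end

theory Submission
  imports Defs
begin

text \<open>Write E for the product of 1 + q^(2k+1) over k \<ge> 0, D(j) for (q^2; q^2)_j and
s(n) for the sum of (-q)^j / D(j) over j \<le> n. Multiplying the mock theta series by
(-q; q)_inf and expanding each (-q^(2n+2); q^2)_inf by Euler's identity gives, after collecting
equal values of n + j, the series E * sum (-1)^n q^(n^2) s(n).

Sorting the partitions by their smallest part, their generating function is the sum of
q^(2m+1) (-q^(2m+2); q)_inf, where each product equals
E (-q^(2m+2); q^2)_inf / (-q; q^2)_(m+1). Expanding with Euler's identity again and summing over m
first leaves series in 1 / (-q; q^2)_(m+1), whose values satisfy a first-order recurrence in j
with the solution (-1)^j D(j) (s(j) - 1/E). The result is E * sum (-1)^j q^(j^2) (s(j) - 1/E),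
which differs from the first series by sum (-1)^j q^(j^2).\<close>

section \<open>Rearrangement of double series\<close>

text \<open>Domination by a product of two geometric series makes the family absolutely summable
  over all pairs, so summation by rows, by columns and along antidiagonals gives one value. One
  bound thus licenses every interchange below.\<close>

lemma double_series_geometric_bound:
  fixes f :: "nat \<Rightarrow> nat \<Rightarrow> 'a :: banach"
  assumes r: "0 \<le> r" "r < 1"
    and bound: "\<And>m j. norm (f m j) \<le> C * r ^ m * r ^ j"
  obtains S where "(\<lambda>m. \<Sum>j. f m j) sums S" "(\<lambda>j. \<Sum>m. f m j) sums S"
    "(\<lambda>n. \<Sum>j\<le>n. f (n - j) j) sums S"
proof -
  have sg: "summable (\<lambda>k. r ^ k)"
    using r by (intro summable_geometric) auto
  have geo: "((\<lambda>k. r ^ k) has_sum (\<Sum>k. r ^ k)) UNIV"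
    using r sg by (intro norm_summable_imp_has_sum) (auto simp: summable_sums)
  have row: "summable (\<lambda>j. norm (f m j))" for m
    by (rule summable_comparison_test'[OF summable_mult[OF sg, of "C * r ^ m"], of 0]) (use bound in simp)
  have col: "summable (\<lambda>m. norm (f m j))" for j
    by (rule summable_comparison_test'[OF summable_mult[OF sg, of "C * r ^ j"], of 0])
      (use bound in \<open>simp add: mult_ac\<close>)
  have "(\<lambda>(m, j). r ^ m * r ^ j) summable_on UNIV \<times> UNIV"
  proof (rule summable_on_SigmaI)
    show "((\<lambda>j. case (m, j) of (m, j) \<Rightarrow> r ^ m * r ^ j) has_sum r ^ m * (\<Sum>k. r ^ k)) UNIV" for m
      unfolding prod.case by (rule has_sum_cmult_right[OF geo])
    show "(\<lambda>m. r ^ m * (\<Sum>k. r ^ k)) summable_on UNIV"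
      by (rule has_sum_imp_summable[OF has_sum_cmult_left[OF geo]])
  qed (use r in auto)
  then have "(\<lambda>x. C * (case x of (m, j) \<Rightarrow> r ^ m * r ^ j)) summable_on UNIV \<times> UNIV"
    by (rule summable_on_cmult_right)
  then have "(\<lambda>(m, j). f m j) abs_summable_on UNIV \<times> UNIV"
    by (rule summable_on_comparison_test) (use bound in \<open>auto simp: mult.assoc\<close>)
  then have "(\<lambda>(m, j). f m j) summable_on UNIV \<times> UNIV"
    by (rule abs_summable_summable)
  then obtain S where S: "((\<lambda>(m, j). f m j) has_sum S) (UNIV \<times> UNIV)"
    by (auto simp: summable_on_def)
  have "((\<lambda>m. \<Sum>j. f m j) has_sum S) UNIV"
    by (rule has_sum_SigmaD[OF S])
      (simp add: norm_summable_imp_has_sum[OF row] summable_sums[OF summable_norm_cancel[OF row]])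
  moreover have "((\<lambda>(j, m). f m j) has_sum S) (UNIV \<times> UNIV)"
    using S by (subst has_sum_reindex_bij_witness[where i = prod.swap and j = prod.swap]) auto
  then have "((\<lambda>j. \<Sum>m. f m j) has_sum S) UNIV"
    by (rule has_sum_SigmaD)
      (simp add: norm_summable_imp_has_sum[OF col] summable_sums[OF summable_norm_cancel[OF col]])
  \<comment> \<open>With \<open>n = m + j\<close>, the pairs of a fixed \<open>n\<close> form a
    finite antidiagonal; \<open>j \<le> n\<close> keeps the natural subtraction exact.\<close>
  moreover have "((\<lambda>(n, j). f (n - j) j) has_sum S) (SIGMA n:UNIV. {..n})"
    using S by (subst has_sum_reindex_bij_witness[where
      i = "\<lambda>(m, j). (m + j, j)" and j = "\<lambda>(n, j). (n - j, j)"]) auto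
  then have "((\<lambda>n. \<Sum>j\<le>n. f (n - j) j) has_sum S) UNIV"
    by (rule has_sum_SigmaD) (auto intro!: has_sum_finite)
  ultimately show ?thesis
    using that has_sum_imp_sums by blast
qed

section \<open>The q-shifted factorial\<close>

lemma qpoch_0 [simp]: "qpoch a q 0 = 1"
  and qpoch_Suc: "qpoch a q (Suc n) = qpoch a q n * (1 - a * q ^ n)"
  by (simp_all add: qpoch_def)

lemma qpoch_add: "qpoch a q (m + n) = qpoch a q m * qpoch (a * q ^ m) q n"
  by (induction n) (simp_all add: qpoch_Suc power_add mult_ac)

lemma qpoch_double: "qpoch a q (2 * n) = qpoch a (q\<^sup>2) n * qpoch (a * q) (q\<^sup>2) n"
  by (induction n) (simp_all add: qpoch_Suc power_mult[symmetric] mult_ac)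

lemma norm_power_less_1:
  fixes q :: complex
  assumes "norm q < 1" "n > 0"
  shows "norm (q ^ n) < 1"
  using assms by (simp add: norm_power power_less_one_iff)

context
  fixes q :: complex
  assumes q: "norm q < 1"
begin

lemma convergent_prod_qpoch: "convergent_prod (\<lambda>k. 1 - a * q ^ k)"
proof (intro abs_convergent_prod_imp_convergent_prod summable_imp_abs_convergent_prod)
  have "summable (\<lambda>k. norm a * norm q ^ k)"
    using q by (intro summable_mult summable_geometric) auto
  then show "summable (\<lambda>k. norm (1 - a * q ^ k - 1))"
    by (simp add: norm_mult norm_power)
qed

lemma qpoch_tendsto: "qpoch a q \<longlonglongrightarrow> qpoch_inf a q"
proof -
  have "(\<lambda>n. qpoch a q (Suc n)) \<longlonglongrightarrow> qpoch_inf a q"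
    using convergent_prod_LIMSEQ[OF convergent_prod_qpoch]
    by (simp add: qpoch_def qpoch_inf_def lessThan_Suc_atMost)
  then show ?thesis
    by (rule LIMSEQ_imp_Suc)
qed

lemma qpoch_inf_split: "qpoch_inf a q = qpoch a q n * qpoch_inf (a * q ^ n) q"
proof -
  have "(\<lambda>m. qpoch a q (n + m)) \<longlonglongrightarrow> qpoch_inf a q"
    using LIMSEQ_ignore_initial_segment[OF qpoch_tendsto, of a n] by (simp add: add.commute)
  moreover have "(\<lambda>m. qpoch a q (n + m)) \<longlonglongrightarrow> qpoch a q n * qpoch_inf (a * q ^ n) q"
    unfolding qpoch_add by (intro tendsto_intros qpoch_tendsto)
  ultimately show ?thesis
    by (rule LIMSEQ_unique)
qed

lemma qpoch_inf_nonzero: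
  assumes "\<And>k. a * q ^ k \<noteq> 1"
  shows "qpoch_inf a q \<noteq> 0"
  unfolding qpoch_inf_def
  by (rule prodinf_nonzero[OF convergent_prod_qpoch]) (use assms in \<open>auto simp: eq_commute[of 1]\<close>)

lemma qpoch_nonzero:
  assumes "\<And>k. a * q ^ k \<noteq> 1"
  shows "qpoch a q n \<noteq> 0"
  using assms by (auto simp: qpoch_def eq_commute[of 1])

lemma mult_power_neq_1:
  assumes "norm a < 1"
  shows "a * q ^ k \<noteq> 1"
proof -
  have "norm (a * q ^ k) \<le> norm a * 1"
    unfolding norm_mult norm_power using q by (intro mult_left_mono power_le_one) auto
  with assms show ?thesis
    by auto
qed

text \<open>The reciprocals converge because the infinite product is nonzero. This supplies the
  constants in the bounds for the double series.\<close>

lemma inverse_qpoch_bounded: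
  assumes "\<And>k. a * q ^ k \<noteq> 1"
  obtains C where "C > 0" "\<And>n. norm (1 / qpoch a q n) \<le> C"
proof -
  have "(\<lambda>n. 1 / qpoch a q n) \<longlonglongrightarrow> 1 / qpoch_inf a q"
    using qpoch_inf_nonzero[OF assms] by (intro tendsto_intros qpoch_tendsto)
  then have "Bseq (\<lambda>n. 1 / qpoch a q n)"
    by (intro convergent_imp_Bseq) (auto simp: convergent_def)
  then show ?thesis
    using that by (auto simp: Bseq_def)
qed

end

text \<open>Even and odd powers of \<open>q\<close> are separated in the finite products of length
  \<open>2 * n\<close>, a subsequence with the same limit.\<close>

lemma qpoch_inf_double:
  assumes "norm q < 1"
  shows "qpoch_inf a q = qpoch_inf a (q\<^sup>2) * qpoch_inf (a * q) (q\<^sup>2)"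
proof (rule LIMSEQ_unique)
  have norm_square_less_1: "norm (q\<^sup>2) < 1"
    using norm_power_less_1[OF assms, of 2] by simp
  have "strict_mono (\<lambda>n::nat. 2 * n)"
    by (auto simp: strict_mono_def)
  from LIMSEQ_subseq_LIMSEQ[OF qpoch_tendsto[OF assms] this]
  show "(\<lambda>n. qpoch a q (2 * n)) \<longlonglongrightarrow> qpoch_inf a q"
    by (simp add: o_def)
  show "(\<lambda>n. qpoch a q (2 * n)) \<longlonglongrightarrow> qpoch_inf a (q\<^sup>2) * qpoch_inf (a * q) (q\<^sup>2)"
    unfolding qpoch_double by (intro tendsto_intros qpoch_tendsto[OF norm_square_less_1])
qed

section \<open>Euler's series for the infinite product\<close>

lemma triangle_number_Suc: "Suc j * (Suc j - 1) div 2 = j * (j - 1) div 2 + j"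
  by (cases j) auto

text \<open>The series \<open>F\<close> satisfies the functional equation
  \<open>F y = (1 + y) * F (y * q)\<close>. Iterating it splits off finite products and drives the
  argument to 0, where \<open>F\<close> is continuous with value 1.\<close>

lemma Euler_sums:
  fixes q x :: complex
  assumes q: "norm q < 1"
  shows "(\<lambda>j. q ^ (j * (j - 1) div 2) * x ^ j / qpoch q q j) sums qpoch_inf (- x) q"
proof -
  define c where "c j = q ^ (j * (j - 1) div 2) / qpoch q q j" for j
  have nz: "qpoch q q j \<noteq> 0" for j
    by (rule qpoch_nonzero[OF q mult_power_neq_1[OF q q]])
  have nz': "1 - q ^ Suc j \<noteq> 0" for j
    using mult_power_neq_1[OF q q, of j] by simp
  \<comment> \<open>This coefficient recurrence yields both the ratio of consecutive terms, which
    tends to 0, and the functional equation.\<close>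
  have c_Suc: "c (Suc j) * (1 - q ^ Suc j) = c j * q ^ j" for j
    using nz'[of j] nz[of j] unfolding c_def triangle_number_Suc
    by (simp add: qpoch_Suc power_add divide_simps)
  have summable: "summable (\<lambda>j. c j * y ^ j)" for y
  proof -
    have q0: "(\<lambda>j. q ^ j) \<longlonglongrightarrow> 0"
      using q by (rule LIMSEQ_power_zero)
    have "(\<lambda>j. norm (q ^ j * y / (1 - q ^ Suc j))) \<longlonglongrightarrow> norm (0 * y / (1 - 0))"
      by (intro tendsto_intros q0 LIMSEQ_Suc[OF q0]) auto
    then have "eventually (\<lambda>j. norm (q ^ j * y / (1 - q ^ Suc j)) < 1 / 2) sequentially"
      by (rule order_tendstoD) auto
    then obtain N where N: "norm (q ^ j * y / (1 - q ^ Suc j)) < 1 / 2" if "j \<ge> N" for j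
      by (auto simp: eventually_sequentially)
    show ?thesis
    proof (rule summable_ratio_test[of "1 / 2" N])
      fix j assume "j \<ge> N"
      have "c (Suc j) * y ^ Suc j = q ^ j * y / (1 - q ^ Suc j) * (c j * y ^ j)"
        using nz'[of j] by (simp add: eq_divide_imp[OF nz' c_Suc])
      then have "norm (c (Suc j) * y ^ Suc j) = norm (q ^ j * y / (1 - q ^ Suc j)) * norm (c j * y ^ j)"
        by (simp only: norm_mult)
      also have "\<dots> \<le> 1 / 2 * norm (c j * y ^ j)"
        using N[OF \<open>j \<ge> N\<close>] by (intro mult_right_mono) auto
      finally show "norm (c (Suc j) * y ^ Suc j) \<le> 1 / 2 * norm (c j * y ^ j)" .
    qed auto
  qed
  define F where "F y = (\<Sum>j. c j * y ^ j)" for y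
  have F: "(\<lambda>j. c j * y ^ j) sums F y" for y
    unfolding F_def by (rule summable_sums[OF summable])
  have step: "F y = (1 + y) * F (y * q)" for y
  proof -
    have "(\<lambda>j. c j * y ^ j - c j * (y * q) ^ j) sums (F y - F (y * q))"
      by (intro sums_diff F)
    \<comment> \<open>The constant terms cancel, so shifting the index leaves the sum
      unchanged.\<close>
    then have "(\<lambda>j. c (Suc j) * y ^ Suc j - c (Suc j) * (y * q) ^ Suc j) sums (F y - F (y * q))"
      by (subst sums_Suc_iff) simp
    moreover have "c (Suc j) * y ^ Suc j - c (Suc j) * (y * q) ^ Suc j = y * (c j * (y * q) ^ j)" for j
    proof -
      have "c (Suc j) * y ^ Suc j - c (Suc j) * (y * q) ^ Suc j = c (Suc j) * (1 - q ^ Suc j) * y ^ Suc j"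
        by (simp add: algebra_simps power_mult_distrib)
      then show ?thesis
        unfolding c_Suc by (simp add: power_mult_distrib mult_ac)
    qed
    ultimately have "(\<lambda>j. y * (c j * (y * q) ^ j)) sums (F y - F (y * q))"
      by simp
    moreover have "(\<lambda>j. y * (c j * (y * q) ^ j)) sums (y * F (y * q))"
      by (intro sums_mult F)
    ultimately have "F y - F (y * q) = y * F (y * q)"
      by (rule sums_unique2)
    then show ?thesis
      by (simp add: algebra_simps)
  qed
  have iterate: "F x = qpoch (- x) q n * F (x * q ^ n)" for n
  proof (induction n)
    case (Suc n)
    then show ?case
      using step[of "x * q ^ n"] by (simp add: qpoch_Suc mult_ac)
  qed simp
  have "isCont F 0"
    unfolding F_def by (rule isCont_powser_converges_everywhere[OF summable])
  moreover have "(\<lambda>n. x * q ^ n) \<longlonglongrightarrow> 0"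
    using tendsto_mult_right_zero[OF LIMSEQ_power_zero[OF q]] .
  ultimately have "(\<lambda>n. F (x * q ^ n)) \<longlonglongrightarrow> F 0"
    by (rule isCont_tendsto_compose)
  then have "(\<lambda>n. qpoch (- x) q n * F (x * q ^ n)) \<longlonglongrightarrow> qpoch_inf (- x) q * F 0"
    by (intro tendsto_mult qpoch_tendsto[OF q])
  then have "F x = qpoch_inf (- x) q * F 0"
    unfolding iterate[symmetric] by (simp add: LIMSEQ_const_iff)
  moreover have "F 0 = 1"
    unfolding F_def by (subst powser_zero) (simp add: c_def)
  ultimately show ?thesis
    using F[of x] by (simp add: c_def)
qed

text \<open>Euler's series with base \<open>q\<^sup>2\<close> and
  \<open>x = q ^ (2 * n + 2)\<close>; the exponent is
  \<open>j * (j - 1) + (2 * n + 2) * j\<close>.\<close>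

lemma even_Euler_sums:
  fixes q :: complex
  assumes q: "norm q < 1"
  shows "(\<lambda>j. q ^ (j\<^sup>2 + (2 * n + 1) * j) / qpoch (q\<^sup>2) (q\<^sup>2) j) sums
    qpoch_inf (- (q ^ (2 * n + 2))) (q\<^sup>2)"
proof -
  have "(q\<^sup>2) ^ (j * (j - 1) div 2) * (q ^ (2 * n + 2)) ^ j = q ^ (j\<^sup>2 + (2 * n + 1) * j)" for j
  proof -
    have "2 * (j * (j - 1) div 2) = j * (j - 1)"
      by (cases j) auto
    moreover have "j * (j - 1) + (2 * n + 2) * j = j\<^sup>2 + (2 * n + 1) * j"
      by (cases j) (auto simp: power2_eq_square algebra_simps)
    ultimately show ?thesis
      by (simp only: power_mult[symmetric] power_add[symmetric])
  qed
  then show ?thesis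
    using Euler_sums[OF norm_power_less_1[OF q, of 2], of "q ^ (2 * n + 2)"] by simp
qed

section \<open>Two expansions over the same partial sums\<close>

text \<open>For \<open>norm q < 1\<close> these truncate Euler's other series, the sum of z^j /
  (q^2; q^2)_j = 1 / (z; q^2)_inf, at z = -q. Hence s(j) - 1/E is minus a tail of that
  series.\<close>

definition even_Euler_partial :: "complex \<Rightarrow> nat \<Rightarrow> complex" where
  "even_Euler_partial q n = (\<Sum>j\<le>n. (- q) ^ j / qpoch (q\<^sup>2) (q\<^sup>2) j)"

context
  fixes q :: complex
  assumes q: "norm q < 1"
begin

lemma norm_square_less_1: "norm (q\<^sup>2) < 1"
  using norm_power_less_1[OF q, of 2] by simp

lemma even_qpoch_neq_1: "q\<^sup>2 * (q\<^sup>2) ^ k \<noteq> 1"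
  by (rule mult_power_neq_1[OF norm_square_less_1 norm_square_less_1])

lemma odd_qpoch_neq_1: "- q * (q\<^sup>2) ^ k \<noteq> 1"
  using q by (intro mult_power_neq_1[OF norm_square_less_1]) auto

lemma even_power_split: "q ^ (2 * n + 2) = q\<^sup>2 * (q\<^sup>2) ^ n"
  by (simp only: power_add power_mult mult.commute[of _ "q\<^sup>2"])

lemma norm_power_le:
  assumes "n \<le> m"
  shows "norm (q ^ m) \<le> norm q ^ n"
  unfolding norm_power using q assms by (intro power_decreasing) auto

text \<open>The factor (-q^2; q^2)_inf turns each denominator (-q^2; q^2)_n into the tail
  (-q^(2n+2); q^2)_inf, which Euler's series expands. Antidiagonal summation then collects the
  powers q^((n+j)^2).\<close>

lemma mock_phi_expansion:
  "(\<lambda>n. (- 1) ^ n * q ^ (n\<^sup>2) * even_Euler_partial q n) sums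
     (qpoch_inf (- (q\<^sup>2)) (q\<^sup>2) * mock_phi (- q))"
proof -
  define D where "D = qpoch (q\<^sup>2) (q\<^sup>2)"
  obtain C where C: "C > 0" "\<And>n. norm (1 / D n) \<le> C"
    unfolding D_def using inverse_qpoch_bounded[OF norm_square_less_1 even_qpoch_neq_1] by blast
  define f where "f n j = (- 1) ^ n * q ^ (n\<^sup>2) * (q ^ (j\<^sup>2 + (2 * n + 1) * j) / D j)" for n j
  have bound: "norm (f n j) \<le> C * norm q ^ n * norm q ^ j" for n j
  proof -
    have "norm (f n j) = norm (1 / D j) * norm (q ^ (n\<^sup>2)) * norm (q ^ (j\<^sup>2 + (2 * n + 1) * j))"
      by (simp add: f_def norm_mult norm_divide norm_power)
    also have "\<dots> \<le> C * norm q ^ n * norm q ^ j"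
      using C by (intro mult_mono norm_power_le) (auto simp: power2_eq_square)
    finally show ?thesis .
  qed
  obtain S where S: "(\<lambda>n. \<Sum>j. f n j) sums S" "(\<lambda>j. \<Sum>n. f n j) sums S"
    "(\<lambda>n. \<Sum>j\<le>n. f (n - j) j) sums S"
    by (rule double_series_geometric_bound[OF norm_ge_zero q bound])
  define K where "K = qpoch_inf (- (q\<^sup>2)) (q\<^sup>2)"
  have neq: "- (q\<^sup>2) * (q\<^sup>2) ^ k \<noteq> 1" for k
    using norm_square_less_1 by (intro mult_power_neq_1) auto
  have K: "K \<noteq> 0"
    unfolding K_def by (rule qpoch_inf_nonzero[OF norm_square_less_1 neq])
  have "(\<Sum>j. f n j) / K = (- q) ^ (n\<^sup>2) / qpoch (- ((- q)\<^sup>2)) ((- q)\<^sup>2) n" for n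
  proof -
    have "(\<Sum>j. f n j) = (- 1) ^ n * q ^ (n\<^sup>2) * qpoch_inf (- (q ^ (2 * n + 2))) (q\<^sup>2)"
      unfolding f_def D_def using sums_mult[OF even_Euler_sums[OF q]] by (rule sums_unique[symmetric])
    moreover have "K = qpoch (- (q\<^sup>2)) (q\<^sup>2) n * qpoch_inf (- (q ^ (2 * n + 2))) (q\<^sup>2)"
      using qpoch_inf_split[OF norm_square_less_1, of "- (q\<^sup>2)" n]
      unfolding K_def even_power_split by simp
    \<comment> \<open>\<open>n\<close> and its square have the same parity.\<close>
    moreover have "(- 1 :: complex) ^ n * q ^ (n\<^sup>2) = (- q) ^ (n\<^sup>2)"
      unfolding power_minus[of q] by (cases "even n") auto
    ultimately show ?thesis
      using K by (simp add: divide_simps)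
  qed
  moreover have "(\<lambda>n. (\<Sum>j. f n j) / K) sums (S / K)"
    by (intro sums_divide S)
  ultimately have "mock_phi (- q) = S / K"
    by (simp add: mock_phi_def sums_iff)
  moreover have "(\<Sum>j\<le>n. f (n - j) j) = (- 1) ^ n * q ^ (n\<^sup>2) * even_Euler_partial q n" for n
    unfolding even_Euler_partial_def sum_distrib_left
  proof (rule sum.cong)
    fix j assume "j \<in> {..n}"
    then obtain i where n: "n = i + j"
      by (auto simp: le_iff_add add.commute)
    \<comment> \<open>The cross term \<open>2 * i * j\<close> completes the square, so only
      \<open>q ^ j\<close> remains to be summed within an antidiagonal.\<close>
    have exponents: "q ^ (i\<^sup>2) * q ^ (j\<^sup>2 + (2 * i + 1) * j) = q ^ ((i + j)\<^sup>2) * q ^ j"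
      unfolding power_add[symmetric] by (rule arg_cong[where f = "(^) q"])
        (simp add: power2_eq_square algebra_simps)
    have signs: "(- 1) ^ i * q ^ j = (- 1) ^ (i + j) * (- q) ^ j"
      unfolding power_add mult.assoc power_mult_distrib[symmetric] by simp
    have "f (n - j) j = (- 1) ^ i * (q ^ (i\<^sup>2) * q ^ (j\<^sup>2 + (2 * i + 1) * j)) / D j"
      by (simp add: f_def n)
    also have "\<dots> = ((- 1) ^ i * q ^ j) * q ^ ((i + j)\<^sup>2) / D j"
      unfolding exponents by (simp add: mult_ac)
    finally show "f (n - j) j = (- 1) ^ n * q ^ (n\<^sup>2) * ((- q) ^ j / qpoch (q\<^sup>2) (q\<^sup>2) j)"
      unfolding signs D_def n by (simp add: mult_ac)
  qed simp
  ultimately show ?thesis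
    using S K by (simp add: K_def)
qed

text \<open>Induction on \<open>j\<close>: the differences of the reciprocals \<open>u\<close>
  telescope for \<open>j = 0\<close>, and in general give w(j+1) = q^(j+1) - (1 - q^(2j+2)) w(j) for
  the values w(j) of the sums.\<close>

lemma odd_reciprocal_sums:
  "(\<lambda>m. q ^ ((2 * j + 2) * m + j + 1) / qpoch (- q) (q\<^sup>2) (Suc m)) sums
     ((- 1) ^ j * qpoch (q\<^sup>2) (q\<^sup>2) j * (even_Euler_partial q j - 1 / qpoch_inf (- q) (q\<^sup>2)))"
proof -
  define D where "D = qpoch (q\<^sup>2) (q\<^sup>2)"
  define u where "u m = 1 / qpoch (- q) (q\<^sup>2) m" for m
  have D_nz: "D j \<noteq> 0" for j
    unfolding D_def by (rule qpoch_nonzero[OF norm_square_less_1 even_qpoch_neq_1])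
  have qpoch_nz: "qpoch (- q) (q\<^sup>2) m \<noteq> 0" for m
    by (rule qpoch_nonzero[OF norm_square_less_1 odd_qpoch_neq_1])
  \<comment> \<open>The denominators of \<open>u m\<close> and \<open>u (Suc m)\<close> differ by
    the factor \<open>1 + q ^ (2 * m + 1)\<close>.\<close>
  have u_diff: "q ^ (2 * m + 1) * u (Suc m) = u m - u (Suc m)" for m
    using qpoch_nz[of m] qpoch_nz[of "Suc m"] unfolding u_def
    by (simp add: qpoch_Suc power_mult divide_simps)
  have u_lim: "u \<longlonglongrightarrow> 1 / qpoch_inf (- q) (q\<^sup>2)"
    unfolding u_def
    by (intro tendsto_intros qpoch_tendsto[OF norm_square_less_1]
      qpoch_inf_nonzero[OF norm_square_less_1 odd_qpoch_neq_1])
  have "(\<lambda>m. q ^ ((2 * j + 2) * m + j + 1) * u (Suc m)) sums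
     ((- 1) ^ j * D j * (even_Euler_partial q j - 1 / qpoch_inf (- q) (q\<^sup>2)))"
  proof (induction j)
    case 0
    have "(\<lambda>m. u m - u (Suc m)) sums (u 0 - 1 / qpoch_inf (- q) (q\<^sup>2))"
      by (rule telescope_sums'[OF u_lim])
    then show ?case
      unfolding u_diff[symmetric] by (simp add: even_Euler_partial_def D_def u_def mult_2)
  next
    case (Suc j)
    define w where "w = (- 1) ^ j * D j * (even_Euler_partial q j - 1 / qpoch_inf (- q) (q\<^sup>2))"
    have "(\<lambda>m. q ^ (2 * j + 2) * (q ^ ((2 * j + 2) * m + j + 1) * u (Suc m))) sums (q ^ (2 * j + 2) * w)"
      unfolding w_def by (intro sums_mult Suc.IH)
    then have "(\<lambda>m. q ^ ((2 * j + 2) * Suc m + j + 1) * u (Suc m)) sums (q ^ (2 * j + 2) * w)"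
      unfolding mult.assoc[symmetric] power_add[symmetric] by (simp add: algebra_simps)
    \<comment> \<open>The summand \<open>q ^ (j + 1)\<close> is the restored term at
      \<open>m = 0\<close>, where \<open>u 0 = 1\<close>.\<close>
    then have "(\<lambda>m. q ^ ((2 * j + 2) * m + j + 1) * u m) sums (q ^ (2 * j + 2) * w + q ^ (j + 1))"
      by (subst (asm) sums_Suc_iff) (simp add: u_def)
    from sums_diff[OF this Suc.IH]
    have "(\<lambda>m. q ^ ((2 * j + 2) * m + j + 1) * (u m - u (Suc m))) sums
        (q ^ (2 * j + 2) * w + q ^ (j + 1) - w)"
      unfolding w_def by (simp add: right_diff_distrib)
    moreover have "q ^ ((2 * j + 2) * m + j + 1) * (u m - u (Suc m))
        = q ^ ((2 * Suc j + 2) * m + Suc j + 1) * u (Suc m)" for m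
      unfolding u_diff[symmetric] mult.assoc[symmetric] power_add[symmetric] by (simp add: algebra_simps)
    \<comment> \<open>Divided by (-1)^(j+1) D(j+1), the recurrence says that s(j) - 1/E grows by
      (-q)^(j+1) / D(j+1), the next term of the partial sum.\<close>
    moreover have "q ^ (2 * j + 2) * w + q ^ (j + 1) - w
        = (- 1) ^ Suc j * D (Suc j) * (even_Euler_partial q (Suc j) - 1 / qpoch_inf (- q) (q\<^sup>2))"
    proof -
      have DS: "D (Suc j) = D j * (1 - q ^ (2 * j + 2))"
        unfolding D_def even_power_split by (simp add: qpoch_Suc)
      define e where "e = 1 / qpoch_inf (- q) (q\<^sup>2)"
      define t where "t = (- q) ^ Suc j / D (Suc j)"
      have "even_Euler_partial q (Suc j) = even_Euler_partial q j + t"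
        by (simp add: even_Euler_partial_def D_def t_def)
      then have "(- 1) ^ Suc j * D (Suc j) * (even_Euler_partial q (Suc j) - 1 / qpoch_inf (- q) (q\<^sup>2))
        = - (1 - q ^ (2 * j + 2)) * w + (- 1) ^ Suc j * (D (Suc j) * t)"
        unfolding w_def DS e_def[symmetric] by (simp add: algebra_simps)
      also have "D (Suc j) * t = (- q) ^ Suc j"
        using D_nz by (simp add: t_def)
      also have "(- 1) ^ Suc j * (- q) ^ Suc j = q ^ (j + 1)"
        by (simp only: power_mult_distrib[symmetric]) simp
      finally show ?thesis
        by (simp add: algebra_simps)
    qed
    ultimately show ?case
      by (simp only:)
  qed
  then show ?thesis
    by (simp add: u_def D_def)
qed

lemma alternating_squares_summable: "summable (\<lambda>j. (- 1) ^ j * q ^ (j\<^sup>2))"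
proof (rule summable_comparison_test'[of "\<lambda>j. norm q ^ j" 0])
  show "summable (\<lambda>j. norm q ^ j)"
    using q by (intro summable_geometric) auto
  show "norm ((- 1) ^ j * q ^ (j\<^sup>2)) \<le> norm q ^ j" for j
    using norm_power_le[of j "j\<^sup>2"] by (simp add: norm_mult norm_power power2_eq_square)
qed

text \<open>\<open>E\<close> times the row sums of one double series gives the left-hand terms. In
  the column sums \<open>D j\<close> cancels against \<open>odd_reciprocal_sums\<close>, leaving the
  terms of \<open>mock_phi_expansion\<close> and, from -1/E, the alternating squares.\<close>

lemma smallest_part_odd_expansion:
  "(\<lambda>m. q ^ (2 * m + 1) * qpoch_inf (- (q ^ (2 * m + 2))) q) sums
     (qpoch_inf (- q) q * mock_phi (- q) - (\<Sum>j. (- 1) ^ j * q ^ (j\<^sup>2)))"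
proof -
  define D where "D = qpoch (q\<^sup>2) (q\<^sup>2)"
  define u where "u m = 1 / qpoch (- q) (q\<^sup>2) m" for m
  define E where "E = qpoch_inf (- q) (q\<^sup>2)"
  have D_nz: "D j \<noteq> 0" for j
    unfolding D_def by (rule qpoch_nonzero[OF norm_square_less_1 even_qpoch_neq_1])
  have qpoch_nz: "qpoch (- q) (q\<^sup>2) m \<noteq> 0" for m
    by (rule qpoch_nonzero[OF norm_square_less_1 odd_qpoch_neq_1])
  have E: "E \<noteq> 0"
    unfolding E_def by (rule qpoch_inf_nonzero[OF norm_square_less_1 odd_qpoch_neq_1])
  obtain C where C: "C > 0" "\<And>n. norm (1 / D n) \<le> C"
    unfolding D_def using inverse_qpoch_bounded[OF norm_square_less_1 even_qpoch_neq_1] by blast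
  obtain C' where C': "C' > 0" "\<And>n. norm (u n) \<le> C'"
    unfolding u_def using inverse_qpoch_bounded[OF norm_square_less_1 odd_qpoch_neq_1] by blast
  define f where "f m j = q ^ (2 * m + 1) * u (Suc m) * (q ^ (j\<^sup>2 + (2 * m + 1) * j) / D j)" for m j
  have bound: "norm (f m j) \<le> C * C' * norm q ^ m * norm q ^ j" for m j
  proof -
    have "norm (f m j) = norm (1 / D j) * norm (u (Suc m)) * norm (q ^ (2 * m + 1))
        * norm (q ^ (j\<^sup>2 + (2 * m + 1) * j))"
      by (simp add: f_def norm_mult norm_divide norm_power)
    also have "\<dots> \<le> C * C' * norm q ^ m * norm q ^ j"
      using C C' by (intro mult_mono norm_power_le) auto
    finally show ?thesis .
  qed
  obtain S where S: "(\<lambda>m. \<Sum>j. f m j) sums S" "(\<lambda>j. \<Sum>m. f m j) sums S"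
    "(\<lambda>n. \<Sum>j\<le>n. f (n - j) j) sums S"
    by (rule double_series_geometric_bound[OF norm_ge_zero q bound])
  \<comment> \<open>The series in \<open>j\<close> supplies the even powers in the product;
    \<open>E * u (Suc m)\<close> supplies the odd ones, from \<open>q ^ (2 * m + 3)\<close>
    on.\<close>
  have row: "E * (\<Sum>j. f m j) = q ^ (2 * m + 1) * qpoch_inf (- (q ^ (2 * m + 2))) q" for m
  proof -
    have "(\<Sum>j. f m j) = q ^ (2 * m + 1) * u (Suc m) * qpoch_inf (- (q ^ (2 * m + 2))) (q\<^sup>2)"
      unfolding f_def D_def using sums_mult[OF even_Euler_sums[OF q]] by (rule sums_unique[symmetric])
    moreover have "E = qpoch (- q) (q\<^sup>2) (Suc m) * qpoch_inf (- (q ^ (2 * m + 2)) * q) (q\<^sup>2)"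
      using qpoch_inf_split[OF norm_square_less_1, of "- q" "Suc m"]
      unfolding E_def even_power_split by (simp add: mult_ac)
    ultimately show ?thesis
      using qpoch_nz qpoch_inf_double[OF q, of "- (q ^ (2 * m + 2))"] by (simp add: u_def)
  qed
  have col: "E * (\<Sum>m. f m j)
      = E * ((- 1) ^ j * q ^ (j\<^sup>2) * even_Euler_partial q j) - (- 1) ^ j * q ^ (j\<^sup>2)" for j
  proof -
    have f_eq: "f m j = q ^ (j\<^sup>2) / D j * (q ^ ((2 * j + 2) * m + j + 1) / qpoch (- q) (q\<^sup>2) (Suc m))" for m
    proof -
      have "q ^ (2 * m + 1) * q ^ (j\<^sup>2 + (2 * m + 1) * j) = q ^ (j\<^sup>2) * q ^ ((2 * j + 2) * m + j + 1)"
        unfolding power_add[symmetric] by (rule arg_cong[where f = "(^) q"]) (simp add: algebra_simps)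
      then show ?thesis
        unfolding f_def u_def by (simp add: mult_ac)
    qed
    have "(\<lambda>m. f m j) sums (q ^ (j\<^sup>2) / D j * ((- 1) ^ j * D j * (even_Euler_partial q j - 1 / E)))"
      unfolding f_eq unfolding D_def E_def by (rule sums_mult[OF odd_reciprocal_sums])
    then have col_eq: "(\<Sum>m. f m j) = (- 1) ^ j * q ^ (j\<^sup>2) * (even_Euler_partial q j - 1 / E)"
      using D_nz by (simp add: sums_iff)
    show ?thesis
      unfolding col_eq using E by (simp add: field_simps)
  qed
  have "(\<lambda>j. E * (\<Sum>m. f m j)) sums
      (E * (qpoch_inf (- (q\<^sup>2)) (q\<^sup>2) * mock_phi (- q)) - (\<Sum>j. (- 1) ^ j * q ^ (j\<^sup>2)))"
    unfolding col
    by (intro sums_diff sums_mult mock_phi_expansion summable_sums alternating_squares_summable)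
  then have "E * S = E * (qpoch_inf (- (q\<^sup>2)) (q\<^sup>2) * mock_phi (- q)) - (\<Sum>j. (- 1) ^ j * q ^ (j\<^sup>2))"
    using sums_mult[OF S(2)] by (rule sums_unique2[symmetric])
  moreover have "qpoch_inf (- q) q = E * qpoch_inf (- (q\<^sup>2)) (q\<^sup>2)"
    unfolding E_def by (subst qpoch_inf_double[OF q]) (simp add: power2_eq_square)
  moreover have "(\<lambda>m. q ^ (2 * m + 1) * qpoch_inf (- (q ^ (2 * m + 2))) q) sums (E * S)"
    using sums_mult[OF S(1), of E] unfolding row .
  ultimately show ?thesis
    by (simp add: mult.assoc)
qed

end

section \<open>Partitions into distinct parts as finite sets\<close>

lemma prod_one_plus_power:
  fixes x :: "'a :: comm_semiring_1"
  assumes "finite A"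
  shows "(\<Prod>k\<in>A. 1 + x ^ k) = (\<Sum>S\<in>Pow A. x ^ \<Sum>S)"
proof -
  have "(\<Prod>k\<in>A. x ^ k + 1) = (\<Sum>S\<in>Pow A. x ^ \<Sum>S)"
    using prod_add[OF assms, of "\<lambda>k. x ^ k" "\<lambda>_. 1"] by (simp add: power_sum)
  then show ?thesis
    by (simp add: add.commute)
qed

text \<open>A finite family of finite sets lies in some \<open>Pow {..<N}\<close>, and the sum of
  norms over it is a finite product bounded by the exponential of a geometric series. Sets
  containing 0 are allowed and account for the factor 2 at \<open>k = 0\<close>.\<close>

lemma finite_sets_power_sum_summable:
  fixes q :: complex
  assumes q: "norm q < 1"
  shows "(\<lambda>S. q ^ \<Sum>S) summable_on {S. finite S}"
proof (rule abs_summable_summable, rule nonneg_bdd_above_summable_on)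
  have "(\<Sum>S\<in>F. norm (q ^ \<Sum>S)) \<le> exp (\<Sum>k. norm q ^ k)" if F: "F \<subseteq> {S. finite S}" "finite F" for F
  proof -
    have "finite (\<Union>F)"
      using F by auto
    then obtain N where N: "\<Union>F \<subseteq> {..<N}"
      using finite_nat_bounded by auto
    have "(\<Sum>S\<in>F. norm (q ^ \<Sum>S)) \<le> (\<Sum>S\<in>Pow {..<N}. norm (q ^ \<Sum>S))"
      using N by (intro sum_mono2) auto
    also have "\<dots> = (\<Prod>k<N. 1 + norm q ^ k)"
      by (simp add: prod_one_plus_power norm_power)
    also have "\<dots> \<le> exp (\<Sum>k<N. norm q ^ k)"
      by (intro prod_le_exp_sum) auto
    also have "(\<Sum>k<N. norm q ^ k) \<le> (\<Sum>k. norm q ^ k)"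
      using q by (intro sum_le_suminf summable_geometric) auto
    finally show ?thesis
      by simp
  qed
  then show "bdd_above (sum (\<lambda>S. norm (q ^ \<Sum>S)) ` {F. F \<subseteq> {S. finite S} \<and> finite F})"
    by (intro bdd_aboveI2[where M = "exp (\<Sum>k. norm q ^ k)"]) auto
qed simp

text \<open>Summability gives some value; it is identified along the exhausting families
  \<open>Pow {a..<a + n}\<close>, whose sums are finite q-products.\<close>

lemma finite_sets_power_sum_has_sum:
  fixes q :: complex
  assumes q: "norm q < 1"
  shows "((\<lambda>S. q ^ \<Sum>S) has_sum qpoch_inf (- (q ^ a)) q) {S. finite S \<and> S \<subseteq> {a..}}"
proof -
  let ?F = "{S. finite S \<and> S \<subseteq> {a..}}"
  have "(\<lambda>S. q ^ \<Sum>S) summable_on ?F"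
    by (rule summable_on_subset_banach[OF finite_sets_power_sum_summable[OF q]]) auto
  then obtain L where L: "((\<lambda>S. q ^ \<Sum>S) has_sum L) ?F"
    by (auto simp: summable_on_def)
  have "filterlim (\<lambda>n. Pow {a..<a + n}) (finite_subsets_at_top ?F) sequentially"
    unfolding filterlim_iff eventually_finite_subsets_at_top
  proof safe
    fix P X
    assume X: "finite X" "X \<subseteq> ?F" and P: "\<forall>Y. finite Y \<and> X \<subseteq> Y \<and> Y \<subseteq> ?F \<longrightarrow> P Y"
    have "finite (\<Union>X)"
      using X by auto
    then obtain N where N: "\<Union>X \<subseteq> {..<N}"
      using finite_nat_bounded by auto
    have "P (Pow {a..<a + n})" if "n \<ge> N" for n
    proof (rule P[rule_format], intro conjI)
      show "X \<subseteq> Pow {a..<a + n}"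
      proof
        fix S assume "S \<in> X"
        then have "S \<subseteq> {..<N}" "S \<subseteq> {a..}"
          using N X(2) by auto
        then show "S \<in> Pow {a..<a + n}"
          using that by fastforce
      qed
      show "Pow {a..<a + n} \<subseteq> ?F"
        by (auto intro: finite_subset[of _ "{a..<a + n}"])
    qed simp
    then show "eventually (\<lambda>n. P (Pow {a..<a + n})) sequentially"
      by (auto simp: eventually_sequentially)
  qed
  then have "(\<lambda>n. \<Sum>S\<in>Pow {a..<a + n}. q ^ \<Sum>S) \<longlonglongrightarrow> L"
    using L unfolding has_sum_def by (rule filterlim_compose[rotated])
  moreover have "(\<Sum>S\<in>Pow {a..<a + n}. q ^ \<Sum>S) = qpoch (- (q ^ a)) q n" for n
    using prod.shift_bounds_nat_ivl[of "\<lambda>k. 1 + q ^ k" 0 a n]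
    by (simp add: prod_one_plus_power[symmetric] qpoch_def power_add add.commute mult.commute lessThan_atLeast0)
  ultimately have "qpoch_inf (- (q ^ a)) q = L"
    using LIMSEQ_unique[OF qpoch_tendsto[OF q]] by simp
  with L show ?thesis
    by simp
qed

section \<open>From multisets to sets, and the generating function\<close>

lemma mset_set_set_mset:
  assumes "distinct_parts p"
  shows "mset_set (set_mset p) = p"
  using assms by (intro multiset_eqI) (auto simp: distinct_parts_def count_mset_set' not_in_iff)

text \<open>A multiset with distinct parts is determined by its support. Positivity of
  \<open>n\<close> excludes the empty partition, for which \<open>Min\<close> has no
  meaning.\<close>

lemma p_do_eq_card_sets:
  assumes "n > 0"
  shows "p_do n = card {S. finite S \<and> S \<noteq> {} \<and> odd (Min S) \<and> \<Sum>S = n}"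
proof -
  have sum: "sum_mset (mset_set S) = \<Sum>S" for S :: "nat set"
    using sum_unfold_sum_mset[of "\<lambda>x. x" S] by simp
  have "bij_betw mset_set {S. finite S \<and> S \<noteq> {} \<and> odd (Min S) \<and> \<Sum>S = n}
      {p \<in> partitions_of n. distinct_parts p \<and> odd (Min (set_mset p))}"
  proof (rule bij_betw_byWitness[where f' = set_mset])
    show "mset_set ` {S. finite S \<and> S \<noteq> {} \<and> odd (Min S) \<and> \<Sum>S = n}
        \<subseteq> {p \<in> partitions_of n. distinct_parts p \<and> odd (Min (set_mset p))}"
    proof clarify
      fix S :: "nat set" assume S: "finite S" "S \<noteq> {}" "odd (Min S)"
      \<comment> \<open>A zero element would be the minimum, which is odd.\<close>
      have "x > 0" if "x \<in> S" for x
        using S that Min_le[of S x] by (cases "x = 0") auto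
      then show "mset_set S \<in> partitions_of (\<Sum>S) \<and> distinct_parts (mset_set S)
          \<and> odd (Min (set_mset (mset_set S)))"
        using S by (auto simp: partitions_of_def distinct_parts_def sum)
    qed
    show "set_mset ` {p \<in> partitions_of n. distinct_parts p \<and> odd (Min (set_mset p))}
        \<subseteq> {S. finite S \<and> S \<noteq> {} \<and> odd (Min S) \<and> \<Sum>S = n}"
    proof clarify
      fix p assume p: "p \<in> partitions_of n" "distinct_parts p" "odd (Min (set_mset p))"
      have "\<Sum>(set_mset p) = n"
        using p sum[of "set_mset p"] by (simp add: mset_set_set_mset partitions_of_def)
      then show "finite (set_mset p) \<and> set_mset p \<noteq> {} \<and> odd (Min (set_mset p)) \<and> \<Sum>(set_mset p) = n"
        using p assms by auto
    qed
  qed (auto simp: mset_set_set_mset)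
  then show ?thesis
    unfolding p_do_def by (simp add: bij_betw_same_card)
qed

text \<open>The sum of \<open>q ^ \<Sum>S\<close> over nonempty finite sets with odd minimum is
  evaluated twice: sorted by the minimum \<open>2 * m + 1\<close> it is \<open>P\<close>, sorted by
  the total it counts partitions.\<close>

lemma p_do_generating_function:
  fixes q :: complex
  assumes q: "norm q < 1"
    and P: "(\<lambda>m. q ^ (2 * m + 1) * qpoch_inf (- (q ^ (2 * m + 2))) q) sums P"
  shows "(\<lambda>n. of_nat (p_do (Suc n)) * q ^ Suc n) sums P"
proof -
  define A where "A = {S :: nat set. finite S \<and> S \<noteq> {} \<and> odd (Min S)}"
  have "(\<lambda>S. q ^ \<Sum>S) summable_on A"
    by (rule summable_on_subset_banach[OF finite_sets_power_sum_summable[OF q]]) (auto simp: A_def)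
  then obtain L where L: "((\<lambda>S. q ^ \<Sum>S) has_sum L) A"
    by (auto simp: summable_on_def)
  have Min_insert': "Min (insert k S) = k" if "finite S" "S \<subseteq> {Suc k..}" for k :: nat and S
    using that by (intro Min_eqI) auto
  \<comment> \<open>Removing the minimum \<open>2 * m + 1\<close> leaves an arbitrary finite set of
    numbers at least \<open>2 * m + 2\<close>; \<open>m\<close> is recovered as
    \<open>Min S div 2\<close>.\<close>
  have "((\<lambda>(m, S). q ^ (2 * m + 1) * q ^ \<Sum>S) has_sum L)
      (SIGMA m:UNIV. {S. finite S \<and> S \<subseteq> {2 * m + 2..}})"
  proof (subst has_sum_reindex_bij_witness[where
      i = "\<lambda>S. (Min S div 2, S - {Min S})" and j = "\<lambda>(m, S). insert (2 * m + 1) S"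
      and T = A and h = "\<lambda>S. q ^ \<Sum>S" and s' = L])
    fix x :: "nat \<times> nat set"
    assume "x \<in> (SIGMA m:UNIV. {S. finite S \<and> S \<subseteq> {2 * m + 2..}})"
    then obtain m S where x: "x = (m, S)" "finite S" "S \<subseteq> {Suc (2 * m + 1)..}"
      by auto
    then have notin: "2 * m + 1 \<notin> S"
      by auto
    note Min = Min_insert'[OF x(2,3)]
    show "(case case x of (m, S) \<Rightarrow> insert (2 * m + 1) S of S \<Rightarrow> (Min S div 2, S - {Min S})) = x"
      unfolding x prod.case Min using notin by simp
    show "(case x of (m, S) \<Rightarrow> insert (2 * m + 1) S) \<in> A"
      unfolding x prod.case A_def mem_Collect_eq Min using x by simp
    show "q ^ \<Sum>(case x of (m, S) \<Rightarrow> insert (2 * m + 1) S)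
        = (case x of (m, S) \<Rightarrow> q ^ (2 * m + 1) * q ^ \<Sum>S)"
      unfolding x prod.case using x(2) notin by (simp add: power_add)
  next
    fix S assume "S \<in> A"
    then have S: "finite S" "S \<noteq> {}" "odd (Min S)"
      by (auto simp: A_def)
    have odd: "2 * (Min S div 2) + 1 = Min S"
      using S(3) by (rule odd_two_times_div_two_succ)
    show "(case (Min S div 2, S - {Min S}) of (m, S) \<Rightarrow> insert (2 * m + 1) S) = S"
      unfolding prod.case odd using insert_Diff[OF Min_in[OF S(1,2)]] by simp
    have "x \<ge> Suc (Min S)" if "x \<in> S - {Min S}" for x
      using that Min_le[OF S(1), of x] by auto
    then show "(Min S div 2, S - {Min S}) \<in> (SIGMA m:UNIV. {S. finite S \<and> S \<subseteq> {2 * m + 2..}})"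
      using S(1) odd by auto
  qed (use L in auto)
  then have "((\<lambda>m. q ^ (2 * m + 1) * qpoch_inf (- (q ^ (2 * m + 2))) q) has_sum L) UNIV"
  proof (rule has_sum_SigmaD)
    show "((\<lambda>S. case (m, S) of (m, S) \<Rightarrow> q ^ (2 * m + 1) * q ^ \<Sum>S) has_sum
        q ^ (2 * m + 1) * qpoch_inf (- (q ^ (2 * m + 2))) q) {S. finite S \<and> S \<subseteq> {2 * m + 2..}}" for m
      unfolding prod.case by (rule has_sum_cmult_right[OF finite_sets_power_sum_has_sum[OF q]])
  qed
  then have "L = P"
    by (rule sums_unique2[OF has_sum_imp_sums P])
  \<comment> \<open>Every total is therefore of the form \<open>Suc n\<close>, and the reindexing by
    \<open>\<Sum>S - 1\<close> loses no set.\<close>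
  have pos: "\<Sum>S > 0" if "S \<in> A" for S
  proof -
    have "odd (Min S)" "Min S \<in> S"
      using that by (simp_all add: A_def)
    then show ?thesis
      using that odd_pos[of "Min S"] by (intro sum_pos2[of S "Min S" "\<lambda>x. x"]) (auto simp: A_def)
  qed
  have "((\<lambda>(n, S). q ^ \<Sum>S) has_sum L) (SIGMA n:UNIV. {S \<in> A. \<Sum>S = Suc n})"
    using pos L by (subst has_sum_reindex_bij_witness[where
      i = "\<lambda>S. (\<Sum>S - 1, S)" and j = snd and T = A and h = "\<lambda>S. q ^ \<Sum>S" and s' = L]) auto
  then have "((\<lambda>n. of_nat (p_do (Suc n)) * q ^ Suc n) has_sum L) UNIV"
  proof (rule has_sum_SigmaD)
    fix n
    have "S \<subseteq> {..Suc n}" if "S \<in> A" "\<Sum>S = Suc n" for S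
      using that member_le_sum[of _ S "\<lambda>x. x"] by (auto simp: A_def)
    then have "finite {S \<in> A. \<Sum>S = Suc n}"
      by (auto intro: finite_subset[of _ "Pow {..Suc n}"])
    moreover have "p_do (Suc n) = card {S \<in> A. \<Sum>S = Suc n}"
      by (subst p_do_eq_card_sets) (auto simp: A_def intro!: arg_cong[where f = card])
    ultimately show "((\<lambda>S. case (n, S) of (n, S) \<Rightarrow> q ^ \<Sum>S) has_sum of_nat (p_do (Suc n)) * q ^ Suc n)
        {S \<in> A. \<Sum>S = Suc n}"
      by (intro has_sum_finiteI) auto
  qed
  then show ?thesis
    unfolding \<open>L = P\<close> by (rule has_sum_imp_sums)
qed

theorem theorem1p2:
  fixes q :: complex
  assumes "norm q < 1"
  shows "qpoch_inf (- q) q * mock_phi (- q) =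
    1 + (\<Sum>n. of_nat (p_do (Suc n)) * q ^ Suc n) + (\<Sum>k. (- 1) ^ Suc k * q ^ ((Suc k)\<^sup>2))"
proof -
  have "(\<Sum>n. of_nat (p_do (Suc n)) * q ^ Suc n)
      = qpoch_inf (- q) q * mock_phi (- q) - (\<Sum>j. (- 1) ^ j * q ^ (j\<^sup>2))"
    using p_do_generating_function[OF assms smallest_part_odd_expansion[OF assms]]
    by (rule sums_unique[symmetric])
  \<comment> \<open>The term at \<open>j = 0\<close> is the constant 1 of the theorem.\<close>
  moreover have "(\<Sum>j. (- 1) ^ j * q ^ (j\<^sup>2)) = 1 + (\<Sum>k. (- 1) ^ Suc k * q ^ ((Suc k)\<^sup>2))"
    using suminf_split_head[OF alternating_squares_summable[OF assms]] by simp
  ultimately show ?thesis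
    by simp
qed

end
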